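(* Let $(V,E,c)$ be a connected infinite network with base-point $o\in V$ and energy Hilbert space $\mathscr{H}_E$, let $c(x):=\sum_{y\sim x}c_{xy}\in(0,\infty]$, and let $x\in V\setminus\{o\}$. Let $\mu_x^{(A)}(\cdot)=\|P^{(A)}(\cdot)\delta_x\|_{l^2}^2$. (1) We have $\delta_x\in\mathscr{H}_E\iff c(x)<\infty$, and in this case $$\int_0^\infty\lambda\,d\mu_x^{(A)}(\lambda)=\|\delta_x\|_{\mathscr{H}_E}^2=c(x).$$ (2) Assume $c(x)<\infty$ (equivalently $\delta_x\in\mathscr{H}_E$) holds for all vertices $x$. Then $$\int_0^\infty\lambda^2\,d\mu_x^{(A)}(\lambda)=c(x)^2+\sum_{y\sim x}c_{xy}^2 .$$ (3) For the covariance of $\mu_x^{(A)}$ we have $$\mathrm{cov}(\mu_x^{(A)})=\sum_{y\sim x}c_{xy}^2\qquad\text{and}\qquad \mathrm{cov}(\mu_x^{(A)})\le\|\delta_x\|_{\mathscr{H}_E}^4 .$$ Here all assertions involving $\mu_x^{(A)}$ are made under the standing assumption that $\delta_y\in\mathscr{H}_E$ for all $y\in V$, which is needed for $A$ and $P^{(A)}$ to be defined.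
   Context: An infinite network $(V,E,c)$: $V$ is a countably infinite set of vertices; $E\subset V\times V\setminus\{\text{diagonal}\}$ is a symmetric set of edges; $c:E\to(0,\infty)$, $(xy)\mapsto c_{xy}$, is symmetric ($c_{xy}=c_{yx}$). Write $x\sim y$ iff $(xy)\in E$. Vertices may have infinitely many neighbours. Connected means any two vertices are joined by a finite path of edges. The energy Hilbert space $\mathscr{H}_E$ consists of functions $f:V\to\mathbb{C}$, modulo constants, with $\|f\|_{\mathscr{H}_E}^2=\frac12\sum_{(xy)\in E}c_{xy}|f(x)-f(y)|^2<\infty$ (sum over ordered pairs), with inner product $\langle f,g\rangle_{\mathscr{H}_E}=\frac12\sum_{(xy)\in E}c_{xy}\overline{(f(x)-f(y))}(g(x)-g(y))$. $\delta_x$ is the function equal to $1$ at $x$ and $0$ elsewhere, viewed in $l^2(V)$ or (as a class modulo constants) in $\mathscr{H}_E$; "$\delta_x\in\mathscr{H}_E$" means it has finite energy norm. When $\delta_y\in\mathscr{H}_E$ for all $y\in V$, $A:l^2(V)\to\mathscr{H}_E$ is the densely defined closable operator with domain $\mathrm{span}\{\delta_y:y\in V\}$ and $A\delta_y=\delta_y$; $\overline{A}$ is its closure, and $P^{(A)}$ is the projection valued spectral measure on $[0,\infty)$ of the selfadjoint operator $A^*\overline{A}$ in $l^2(V)$. The covariance (variance) of $\mu_x^{(A)}$ is $\mathrm{cov}(\mu_x^{(A)})=\int_0^\infty|\lambda-m|^2d\mu_x^{(A)}(\lambda)$, where $m=\int_0^\infty\lambda\,d\mu_x^{(A)}(\lambda)$.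 *)

theory Defs
  imports "HOL-Analysis.Analysis"
begin

text \<open>
  The vertex set is the whole type \<open>'v\<close>. The conductances \<open>c x y\<close> matter
  only for edges \<open>(x, y) \<in> E\<close>; sums involving \<open>c\<close> range over edges only.
\<close>

locale infinite_network =
  fixes E :: "('v \<times> 'v) set" and c :: "'v \<Rightarrow> 'v \<Rightarrow> real"
  assumes countable_vertices: "countable (UNIV :: 'v set)"
    and infinite_vertices: "infinite (UNIV :: 'v set)"
    and sym_edges: "sym E"
    and irrefl_edges: "irrefl E"
    and conductance_pos: "(x, y) \<in> E \<Longrightarrow> 0 < c x y"
    and conductance_sym: "(x, y) \<in> E \<Longrightarrow> c x y = c y x"

locale connected_network = infinite_network +
  assumes connected: "(x, y) \<in> E\<^sup>*"

definition neighbours :: "('v \<times> 'v) set \<Rightarrow> 'v \<Rightarrow> 'v set" where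
  "neighbours E x = {y. (x, y) \<in> E}"

definition total_conductance :: "('v \<times> 'v) set \<Rightarrow> ('v \<Rightarrow> 'v \<Rightarrow> real) \<Rightarrow> 'v \<Rightarrow> ennreal" where
  "total_conductance E c x = (\<Sum>\<^sub>\<infinity>y\<in>neighbours E x. ennreal (c x y))"

definition delta :: "'v \<Rightarrow> 'v \<Rightarrow> complex" where
  "delta x = (\<lambda>v. if v = x then 1 else 0)"

definition l2 :: "('v \<Rightarrow> complex) set" where
  "l2 = {f. (\<lambda>v. (cmod (f v))\<^sup>2) summable_on UNIV}"

definition l2_inner :: "('v \<Rightarrow> complex) \<Rightarrow> ('v \<Rightarrow> complex) \<Rightarrow> complex" where
  "l2_inner f g = (\<Sum>\<^sub>\<infinity>v. cnj (f v) * g v)"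

definition l2_norm :: "('v \<Rightarrow> complex) \<Rightarrow> real" where
  "l2_norm f = sqrt (\<Sum>\<^sub>\<infinity>v. (cmod (f v))\<^sup>2)"

quotient_type 'v mod_const = "'v \<Rightarrow> complex" / "\<lambda>f g. \<exists>k. \<forall>v. f v = g v + k"
proof (rule equivpI)
  show "reflp (\<lambda>f g :: 'v \<Rightarrow> complex. \<exists>k. \<forall>v. f v = g v + k)"
    by (rule reflpI) (rule exI[of _ 0], simp)
  show "symp (\<lambda>f g :: 'v \<Rightarrow> complex. \<exists>k. \<forall>v. f v = g v + k)"
  proof (rule sympI)
    fix f g :: "'v \<Rightarrow> complex"
    assume "\<exists>k. \<forall>v. f v = g v + k"
    then obtain k where "\<forall>v. f v = g v + k" ..
    then show "\<exists>k. \<forall>v. g v = f v + k" by (intro exI[of _ "- k"]) simp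
  qed
  show "transp (\<lambda>f g :: 'v \<Rightarrow> complex. \<exists>k. \<forall>v. f v = g v + k)"
  proof (rule transpI)
    fix f g h :: "'v \<Rightarrow> complex"
    assume "\<exists>k. \<forall>v. f v = g v + k" "\<exists>k. \<forall>v. g v = h v + k"
    then obtain k l where "\<forall>v. f v = g v + k" "\<forall>v. g v = h v + l" by blast
    then show "\<exists>k. \<forall>v. f v = h v + k" by (intro exI[of _ "l + k"]) simp
  qed
qed

lift_definition class_of :: "('v \<Rightarrow> complex) \<Rightarrow> 'v mod_const" is "\<lambda>f. f" .

instantiation mod_const :: (type) ab_group_add
begin

lift_definition zero_mod_const :: "'a mod_const" is "\<lambda>v. 0" .

lift_definition plus_mod_const :: "'a mod_const \<Rightarrow> 'a mod_const \<Rightarrow> 'a mod_const"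
  is "\<lambda>f g v. f v + g v"
proof -
  fix f f' g g' :: "'a \<Rightarrow> complex"
  assume "\<exists>k. \<forall>v. f v = f' v + k" "\<exists>k. \<forall>v. g v = g' v + k"
  then obtain k l where "\<forall>v. f v = f' v + k" "\<forall>v. g v = g' v + l" by blast
  then show "\<exists>k. \<forall>v. f v + g v = f' v + g' v + k" by (intro exI[of _ "k + l"]) simp
qed

lift_definition uminus_mod_const :: "'a mod_const \<Rightarrow> 'a mod_const" is "\<lambda>f v. - f v"
proof -
  fix f f' :: "'a \<Rightarrow> complex"
  assume "\<exists>k. \<forall>v. f v = f' v + k"
  then obtain k where "\<forall>v. f v = f' v + k" ..
  then show "\<exists>k. \<forall>v. - f v = - f' v + k" by (intro exI[of _ "- k"]) simp
qed

lift_definition minus_mod_const :: "'a mod_const \<Rightarrow> 'a mod_const \<Rightarrow> 'a mod_const"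
  is "\<lambda>f g v. f v - g v"
proof -
  fix f f' g g' :: "'a \<Rightarrow> complex"
  assume "\<exists>k. \<forall>v. f v = f' v + k" "\<exists>k. \<forall>v. g v = g' v + k"
  then obtain k l where "\<forall>v. f v = f' v + k" "\<forall>v. g v = g' v + l" by blast
  then show "\<exists>k. \<forall>v. f v - g v = f' v - g' v + k" by (intro exI[of _ "k - l"]) simp
qed

instance
proof
  fix a b d :: "'a mod_const"
  show "a + b + d = a + (b + d)" by transfer (rule exI[of _ 0], simp add: add.assoc)
  show "a + b = b + a" by transfer (rule exI[of _ 0], simp add: add.commute)
  show "0 + a = a" by transfer (rule exI[of _ 0], simp)
  show "- a + a = 0" by transfer (rule exI[of _ 0], simp)
  show "a - b = a + - b" by transfer (rule exI[of _ 0], simp)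
qed

end

lift_definition scale_mod_const :: "complex \<Rightarrow> 'v mod_const \<Rightarrow> 'v mod_const"
  is "\<lambda>a f v. a * f v"
proof -
  fix a :: complex and f f' :: "'v \<Rightarrow> complex"
  assume "\<exists>k. \<forall>v. f v = f' v + k"
  then obtain k where "\<forall>v. f v = f' v + k" ..
  then show "\<exists>k. \<forall>v. a * f v = a * f' v + k"
    by (intro exI[of _ "a * k"]) (simp add: distrib_left)
qed

lemma diff_mod_const:
  fixes f g :: "'v \<Rightarrow> complex"
  assumes "\<exists>k. \<forall>v. f v = g v + k"
  shows "f x - f y = g x - g y"
  using assms by auto

lift_definition finite_energy ::
    "('v \<times> 'v) set \<Rightarrow> ('v \<Rightarrow> 'v \<Rightarrow> real) \<Rightarrow> 'v mod_const \<Rightarrow> bool"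
  is "\<lambda>E c f. (\<lambda>(x, y). c x y * (cmod (f x - f y))\<^sup>2) summable_on E"
  by (simp only: diff_mod_const)

definition energy_space ::
    "('v \<times> 'v) set \<Rightarrow> ('v \<Rightarrow> 'v \<Rightarrow> real) \<Rightarrow> 'v mod_const set" where
  "energy_space E c = {f. finite_energy E c f}"

lift_definition energy_inner ::
    "('v \<times> 'v) set \<Rightarrow> ('v \<Rightarrow> 'v \<Rightarrow> real) \<Rightarrow> 'v mod_const \<Rightarrow> 'v mod_const \<Rightarrow> complex"
  is "\<lambda>E c f g. 1 / 2 * (\<Sum>\<^sub>\<infinity>(x, y)\<in>E. of_real (c x y) * cnj (f x - f y) * (g x - g y))"
  by (simp only: diff_mod_const)

lift_definition energy_norm ::
    "('v \<times> 'v) set \<Rightarrow> ('v \<Rightarrow> 'v \<Rightarrow> real) \<Rightarrow> 'v mod_const \<Rightarrow> real"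
  is "\<lambda>E c f. sqrt (1 / 2 * (\<Sum>\<^sub>\<infinity>(x, y)\<in>E. c x y * (cmod (f x - f y))\<^sup>2))"
  by (simp only: diff_mod_const)

text \<open>
  Unbounded operators are represented by their graphs; the sums below are the
  elements of the complex span of the point masses.
\<close>

definition op_A :: "(('v \<Rightarrow> complex) \<times> 'v mod_const) set" where
  "op_A = {(\<lambda>v. \<Sum>y\<in>F. a y * delta y v, \<Sum>y\<in>F. scale_mod_const (a y) (class_of (delta y))) |
     F a. finite F}"

definition op_closure ::
    "('v \<times> 'v) set \<Rightarrow> ('v \<Rightarrow> 'v \<Rightarrow> real) \<Rightarrow> (('v \<Rightarrow> complex) \<times> 'v mod_const) set
      \<Rightarrow> (('v \<Rightarrow> complex) \<times> 'v mod_const) set" where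
  "op_closure E c T = {(f, h). f \<in> l2 \<and> h \<in> energy_space E c \<and>
     (\<exists>u k. (\<forall>n::nat. (u n, k n) \<in> T) \<and>
        (\<lambda>n. l2_norm (\<lambda>v. u n v - f v)) \<longlonglongrightarrow> 0 \<and>
        (\<lambda>n. energy_norm E c (k n - h)) \<longlonglongrightarrow> 0)}"

definition op_adjoint ::
    "('v \<times> 'v) set \<Rightarrow> ('v \<Rightarrow> 'v \<Rightarrow> real) \<Rightarrow> (('v \<Rightarrow> complex) \<times> 'v mod_const) set
      \<Rightarrow> ('v mod_const \<times> ('v \<Rightarrow> complex)) set" where
  "op_adjoint E c T = {(h, g). h \<in> energy_space E c \<and> g \<in> l2 \<and>
     (\<forall>(f, k)\<in>T. energy_inner E c h k = l2_inner g f)}"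

text \<open>The graph of \<open>A\<^sup>* \<circ> cl A\<close>; note that \<open>(O)\<close> applies its left argument first.\<close>

definition op_AstarA ::
    "('v \<times> 'v) set \<Rightarrow> ('v \<Rightarrow> 'v \<Rightarrow> real) \<Rightarrow> (('v \<Rightarrow> complex) \<times> ('v \<Rightarrow> complex)) set" where
  "op_AstarA E c = op_closure E c op_A O op_adjoint E c op_A"

abbreviation borel_nonneg :: "real measure" where
  "borel_nonneg \<equiv> restrict_space borel {0..}"

definition orth_projection :: "(('v \<Rightarrow> complex) \<Rightarrow> ('v \<Rightarrow> complex)) \<Rightarrow> bool" where
  "orth_projection Q \<longleftrightarrow>
     (\<forall>f\<in>l2. Q f \<in> l2) \<and>
     (\<forall>f\<in>l2. \<forall>g\<in>l2. Q (\<lambda>v. f v + g v) = (\<lambda>v. Q f v + Q g v)) \<and>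
     (\<forall>a. \<forall>f\<in>l2. Q (\<lambda>v. a * f v) = (\<lambda>v. a * Q f v)) \<and>
     (\<forall>f\<in>l2. Q (Q f) = Q f) \<and>
     (\<forall>f\<in>l2. \<forall>g\<in>l2. l2_inner (Q f) g = l2_inner f (Q g))"

definition proj_valued_measure ::
    "(real set \<Rightarrow> ('v \<Rightarrow> complex) \<Rightarrow> ('v \<Rightarrow> complex)) \<Rightarrow> bool" where
  "proj_valued_measure P \<longleftrightarrow>
     (\<forall>B\<in>sets borel_nonneg. orth_projection (P B)) \<and>
     (\<forall>f\<in>l2. P {} f = (\<lambda>v. 0)) \<and>
     (\<forall>f\<in>l2. P {0..} f = f) \<and>
     (\<forall>B\<in>sets borel_nonneg. \<forall>C\<in>sets borel_nonneg. \<forall>f\<in>l2. P (B \<inter> C) f = P B (P C f)) \<and>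
     (\<forall>B :: nat \<Rightarrow> real set. range B \<subseteq> sets borel_nonneg \<longrightarrow> disjoint_family B \<longrightarrow>
        (\<forall>f\<in>l2. (\<lambda>n. l2_norm (\<lambda>v. (\<Sum>i<n. P (B i) f v) - P (\<Union>i. B i) f v)) \<longlonglongrightarrow> 0))"

definition spectral_dist ::
    "(real set \<Rightarrow> ('v \<Rightarrow> complex) \<Rightarrow> ('v \<Rightarrow> complex)) \<Rightarrow> ('v \<Rightarrow> complex) \<Rightarrow> real measure" where
  "spectral_dist P f =
     measure_of {0..} (sets borel_nonneg) (\<lambda>B. ennreal ((l2_norm (P B f))\<^sup>2))"

definition simple_spectral_integral ::
    "(real set \<Rightarrow> ('v \<Rightarrow> complex) \<Rightarrow> ('v \<Rightarrow> complex)) \<Rightarrow> (real \<Rightarrow> real)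
      \<Rightarrow> ('v \<Rightarrow> complex) \<Rightarrow> ('v \<Rightarrow> complex)" where
  "simple_spectral_integral P s f =
     (\<lambda>v. \<Sum>a\<in>s ` {0..}. of_real a * P (s -` {a} \<inter> {0..}) f v)"

text \<open>
  The graph of the operator \<open>\<integral> \<phi> dP\<close>: by the isometry
  \<open>\<parallel>(\<integral> s dP) f\<parallel>\<^sup>2 = \<integral> s\<^sup>2 d\<parallel>P f\<parallel>\<^sup>2\<close> for simple \<open>s\<close>, the integral applied to
  \<open>f\<close> is the limit along any simple functions approximating \<open>\<phi>\<close> in
  \<open>L\<^sup>2(spectral_dist P f)\<close>. Such an approximation exists precisely when \<open>\<phi>\<close> is
  in that space, so the domain is \<open>{f. \<integral> \<phi>\<^sup>2 d\<parallel>P f\<parallel>\<^sup>2 < \<infinity>}\<close>.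
\<close>

definition spectral_integral ::
    "(real set \<Rightarrow> ('v \<Rightarrow> complex) \<Rightarrow> ('v \<Rightarrow> complex)) \<Rightarrow> (real \<Rightarrow> real)
      \<Rightarrow> (('v \<Rightarrow> complex) \<times> ('v \<Rightarrow> complex)) set" where
  "spectral_integral P \<phi> = {(f, g). f \<in> l2 \<and> g \<in> l2 \<and>
     (\<exists>s. (\<forall>n::nat. simple_function borel_nonneg (s n)) \<and>
        (\<lambda>n. \<integral>\<^sup>+ t. ennreal ((s n t - \<phi> t)\<^sup>2) \<partial>spectral_dist P f) \<longlonglongrightarrow> 0 \<and>
        (\<lambda>n. l2_norm (\<lambda>v. simple_spectral_integral P (s n) f v - g v)) \<longlonglongrightarrow> 0)}"

definition spectral_measure_of ::
    "(('v \<Rightarrow> complex) \<times> ('v \<Rightarrow> complex)) set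
      \<Rightarrow> (real set \<Rightarrow> ('v \<Rightarrow> complex) \<Rightarrow> ('v \<Rightarrow> complex)) \<Rightarrow> bool" where
  "spectral_measure_of T P \<longleftrightarrow> proj_valued_measure P \<and> T = spectral_integral P (\<lambda>t. t)"

definition covariance :: "real measure \<Rightarrow> ennreal" where
  "covariance M = (\<integral>\<^sup>+ t. ennreal (\<bar>t - (\<integral>r. r \<partial>M)\<bar>\<^sup>2) \<partial>M)"

end

theory Submission
  imports Defs
begin

text \<open>
  The point mass at \<open>x\<close> lies in the domain of \<open>A\<^sup>* cl A\<close>, and its image \<open>g\<close> is
  given by the graph Laplacian: \<open>c(x)\<close> at \<open>x\<close>, \<open>- c\<^sub>x\<^sub>y\<close> at each neighbour \<open>y\<close>.
  By the spectral theorem the first two moments of the spectral distribution are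
  \<open>\<langle>\<delta>\<^sub>x, g\<rangle> = c(x)\<close> and \<open>\<parallel>g\<parallel>\<^sup>2 = c(x)\<^sup>2 + \<Sum> c\<^sub>x\<^sub>y\<^sup>2\<close>. Self-adjointness plays no role: the
  isometry for simple functions passes to the limit in the definition of the spectral integral.
\<close>

section \<open>Infinite sums of nonnegative reals\<close>

text \<open>Both sides are the supremum of the same finite partial sums, taken once in the extended
  and once in the real numbers.\<close>

lemma infsum_ennreal:
  assumes "f summable_on A" "\<And>x. x \<in> A \<Longrightarrow> 0 \<le> f x"
  shows "(\<Sum>\<^sub>\<infinity>x\<in>A. ennreal (f x)) = ennreal (infsum f A)"
proof -
  have "(\<Sum>\<^sub>\<infinity>x\<in>A. ennreal (f x)) = (SUP F\<in>{F. finite F \<and> F \<subseteq> A}. \<Sum>x\<in>F. ennreal (f x))"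
    by (rule nonneg_infsum_complete) simp
  also have "\<dots> = (SUP F\<in>{F. finite F \<and> F \<subseteq> A}. ennreal (sum f F))"
    using assms(2) by (intro SUP_cong refl) (auto intro!: sum_ennreal)
  finally show ?thesis
    by (simp add: infsum_nonneg_is_SUPREMUM_ennreal[OF assms])
qed

text \<open>The extended sum dominates every finite partial sum; when it is finite, its real value
  bounds them all. This turns finiteness of \<open>c(x)\<close> into real summability.\<close>

lemma summable_on_if_infsum_ennreal_finite:
  assumes "(\<Sum>\<^sub>\<infinity>x\<in>A. ennreal (f x)) < \<infinity>" and f: "\<And>x. x \<in> A \<Longrightarrow> 0 \<le> f x"
  shows "f summable_on A"
proof (rule nonneg_bounded_partial_sums_imp_summable_on[where C = "enn2real (\<Sum>\<^sub>\<infinity>x\<in>A. ennreal (f x))"])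
  have "sum f F \<le> enn2real (\<Sum>\<^sub>\<infinity>x\<in>A. ennreal (f x))" if F: "finite F" "F \<subseteq> A" for F
  proof -
    have "ennreal (sum f F) = (\<Sum>x\<in>F. ennreal (f x))"
      using F f by (intro sum_ennreal[symmetric]) auto
    also have "\<dots> \<le> (\<Sum>\<^sub>\<infinity>x\<in>A. ennreal (f x))"
      using F by (subst nonneg_infsum_complete) (auto intro: SUP_upper)
    finally show ?thesis
      using enn2real_mono[of "ennreal (sum f F)" "\<Sum>\<^sub>\<infinity>x\<in>A. ennreal (f x)"] assms(1) F f
      by (simp add: sum_nonneg subset_iff)
  qed
  then show "\<forall>\<^sub>F F in finite_subsets_at_top A. sum f F \<le> enn2real (\<Sum>\<^sub>\<infinity>x\<in>A. ennreal (f x))"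
    by (auto intro: eventually_finite_subsets_at_top_weakI)
qed (use f in auto)

text \<open>A single term is at most the total, so its square is at most the total times the term.
  Summing this domination yields both claims; the inequality is the source of the bound on the
  covariance.\<close>

lemma
  fixes f :: "'a \<Rightarrow> real"
  assumes f: "f summable_on A" "\<And>x. x \<in> A \<Longrightarrow> 0 \<le> f x"
  shows summable_on_power2: "(\<lambda>x. (f x)\<^sup>2) summable_on A"
    and infsum_power2_le: "(\<Sum>\<^sub>\<infinity>x\<in>A. (f x)\<^sup>2) \<le> (infsum f A)\<^sup>2"
proof -
  have le: "(f x)\<^sup>2 \<le> infsum f A * f x" if "x \<in> A" for x
    using that f finite_sum_le_infsum[of f A "{x}"]
    by (simp add: power2_eq_square mult_right_mono)
  have s: "(\<lambda>x. infsum f A * f x) summable_on A"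
    using f by (intro summable_on_cmult_right)
  show sq: "(\<lambda>x. (f x)\<^sup>2) summable_on A"
    by (rule summable_on_comparison_test[OF s]) (use le in auto)
  show "(\<Sum>\<^sub>\<infinity>x\<in>A. (f x)\<^sup>2) \<le> (infsum f A)\<^sup>2"
    using infsum_mono[OF sq s le] f by (simp add: infsum_cmult_right power2_eq_square)
qed

section \<open>The space of square-summable functions\<close>

lemma l2_product_summable:
  assumes "f \<in> l2" "g \<in> l2"
  shows "(\<lambda>v. cmod (f v) * cmod (g v)) summable_on UNIV"
proof (rule summable_on_comparison_test)
  show "(\<lambda>v. (cmod (f v))\<^sup>2 + (cmod (g v))\<^sup>2) summable_on UNIV"
    using assms by (intro summable_on_add) (auto simp: l2_def)
  show "cmod (f v) * cmod (g v) \<le> (cmod (f v))\<^sup>2 + (cmod (g v))\<^sup>2" for v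
    using sum_squares_bound[of "cmod (f v)" "cmod (g v)"]
      mult_nonneg_nonneg[OF norm_ge_zero[of "f v"] norm_ge_zero[of "g v"]] by linarith
qed simp

lemma l2_inner_summable:
  assumes "f \<in> l2" "g \<in> l2"
  shows "(\<lambda>v. cnj (f v) * g v) summable_on UNIV"
  by (rule abs_summable_summable) (simp add: norm_mult l2_product_summable assms)

lemma l2_add:
  assumes "f \<in> l2" "g \<in> l2"
  shows "(\<lambda>v. f v + g v) \<in> l2"
  unfolding l2_def
proof (rule CollectI, rule summable_on_comparison_test)
  show "(\<lambda>v. 2 * (cmod (f v))\<^sup>2 + 2 * (cmod (g v))\<^sup>2) summable_on UNIV"
    using assms by (intro summable_on_add summable_on_cmult_right) (auto simp: l2_def)
  show "(cmod (f v + g v))\<^sup>2 \<le> 2 * (cmod (f v))\<^sup>2 + 2 * (cmod (g v))\<^sup>2" for v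
    using power_mono[OF norm_triangle_ineq[of "f v" "g v"], of 2]
      sum_squares_bound[of "cmod (f v)" "cmod (g v)"] by (simp add: power2_sum)
qed simp

lemma l2_scale: "f \<in> l2 \<Longrightarrow> (\<lambda>v. a * f v) \<in> l2"
  by (simp add: l2_def norm_mult power_mult_distrib summable_on_cmult_right)

lemma l2_diff: "f \<in> l2 \<Longrightarrow> g \<in> l2 \<Longrightarrow> (\<lambda>v. f v - g v) \<in> l2"
  using l2_add[of f "\<lambda>v. - 1 * g v"] l2_scale[of g "- 1"] by simp

lemma l2_sum: "(\<And>i. i \<in> I \<Longrightarrow> f i \<in> l2) \<Longrightarrow> (\<lambda>v. \<Sum>i\<in>I. f i v) \<in> l2"
proof (induction I rule: infinite_finite_induct)
  case (insert i I)
  then show ?case by (simp add: l2_add)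
qed (simp_all add: l2_def)

lemma l2_inner_commute: "l2_inner g f = cnj (l2_inner f g)"
  unfolding l2_inner_def by (subst infsum_cnj[symmetric]) (simp add: mult.commute)

lemma l2_inner_scale_right: "l2_inner f (\<lambda>v. a * g v) = a * l2_inner f g"
  by (simp add: l2_inner_def mult.left_commute infsum_cmult_right')

lemma l2_inner_add_right:
  "f \<in> l2 \<Longrightarrow> g \<in> l2 \<Longrightarrow> h \<in> l2 \<Longrightarrow>
    l2_inner f (\<lambda>v. g v + h v) = l2_inner f g + l2_inner f h"
  by (simp add: l2_inner_def distrib_left infsum_add l2_inner_summable)

lemma l2_inner_diff_right:
  "f \<in> l2 \<Longrightarrow> g \<in> l2 \<Longrightarrow> h \<in> l2 \<Longrightarrow>
    l2_inner f (\<lambda>v. g v - h v) = l2_inner f g - l2_inner f h"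
  using l2_inner_add_right[of f g "\<lambda>v. - 1 * h v"] l2_scale[of h "- 1"] l2_inner_scale_right[of f "- 1" h]
  by simp

lemma l2_inner_sum_right:
  "f \<in> l2 \<Longrightarrow> (\<And>i. i \<in> I \<Longrightarrow> g i \<in> l2) \<Longrightarrow>
    l2_inner f (\<lambda>v. \<Sum>i\<in>I. g i v) = (\<Sum>i\<in>I. l2_inner f (g i))"
proof (induction I rule: infinite_finite_induct)
  case (insert i I)
  then show ?case by (simp add: l2_inner_add_right l2_sum)
qed (simp_all add: l2_inner_def)

lemma l2_inner_sum_left:
  "f \<in> l2 \<Longrightarrow> (\<And>i. i \<in> I \<Longrightarrow> g i \<in> l2) \<Longrightarrow>
    l2_inner (\<lambda>v. \<Sum>i\<in>I. g i v) f = (\<Sum>i\<in>I. l2_inner (g i) f)"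
  using l2_inner_sum_right[of f I g] by (simp add: l2_inner_commute[of _ f])

lemma l2_inner_add_left:
  "f \<in> l2 \<Longrightarrow> g \<in> l2 \<Longrightarrow> h \<in> l2 \<Longrightarrow>
    l2_inner (\<lambda>v. g v + h v) f = l2_inner g f + l2_inner h f"
  using l2_inner_add_right[of f g h]
    l2_inner_commute[of "\<lambda>v. g v + h v" f] l2_inner_commute[of g f] l2_inner_commute[of h f]
  by (simp only: complex_cnj_add)

lemma l2_inner_scale_left: "l2_inner (\<lambda>v. a * f v) g = cnj a * l2_inner f g"
  using l2_inner_scale_right[of g a f] l2_inner_commute[of "\<lambda>v. a * f v" g] l2_inner_commute[of f g]
  by (simp only: complex_cnj_mult)

lemma l2_norm_nonneg: "0 \<le> l2_norm f"
  by (simp add: l2_norm_def infsum_nonneg)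

lemma l2_norm_power2: "(l2_norm f)\<^sup>2 = (\<Sum>\<^sub>\<infinity>v. (cmod (f v))\<^sup>2)"
  by (simp add: l2_norm_def infsum_nonneg)

lemma l2_inner_self:
  assumes "f \<in> l2"
  shows "l2_inner f f = of_real ((l2_norm f)\<^sup>2)"
proof -
  have "((\<lambda>v. of_real ((cmod (f v))\<^sup>2)) has_sum complex_of_real ((l2_norm f)\<^sup>2)) UNIV"
    unfolding l2_norm_power2 using assms by (intro has_sum_of_real has_sum_infsum) (simp add: l2_def)
  then show ?thesis
    unfolding l2_inner_def by (intro infsumI) (simp only: complex_norm_square mult.commute)
qed

text \<open>The finite Cauchy-Schwarz inequality for \<open>L2_set\<close> bounds each partial sum
  of the moduli by the same product of norms, so the bound survives in the infinite sum.\<close>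

lemma l2_cauchy_schwarz:
  assumes f: "f \<in> l2" and g: "g \<in> l2"
  shows "cmod (l2_inner f g) \<le> l2_norm f * l2_norm g"
proof -
  have "cmod (l2_inner f g) \<le> (\<Sum>\<^sub>\<infinity>v. cmod (f v) * cmod (g v))"
    unfolding l2_inner_def
    using norm_infsum_bound[of "\<lambda>v. cnj (f v) * g v" UNIV] l2_product_summable[OF f g]
    by (simp add: norm_mult)
  also have "\<dots> \<le> l2_norm f * l2_norm g"
  proof (rule infsum_le_finite_sums[OF l2_product_summable[OF f g]])
    fix F :: "'a set"
    assume F: "finite F"
    have norm_le: "L2_set (\<lambda>v. cmod (h v)) F \<le> l2_norm h" if "h \<in> l2" for h :: "'a \<Rightarrow> complex"
      unfolding L2_set_def l2_norm_def
      using that F by (intro real_sqrt_le_mono finite_sum_le_infsum) (auto simp: l2_def)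
    have "(\<Sum>v\<in>F. cmod (f v) * cmod (g v)) \<le> L2_set (\<lambda>v. cmod (f v)) F * L2_set (\<lambda>v. cmod (g v)) F"
      using L2_set_mult_ineq[of "\<lambda>v. cmod (f v)" "\<lambda>v. cmod (g v)" F] by simp
    also have "\<dots> \<le> l2_norm f * l2_norm g"
      using f g by (intro mult_mono norm_le) (auto simp: l2_norm_nonneg)
    finally show "(\<Sum>v\<in>F. cmod (f v) * cmod (g v)) \<le> l2_norm f * l2_norm g" .
  qed
  finally show ?thesis .
qed

text \<open>Norm convergence implies weak convergence: the difference of the inner products is at
  most \<open>l2_norm h\<close> times the distance from \<open>u n\<close> to
  \<open>g\<close>.\<close>

lemma l2_inner_tendsto:
  assumes "h \<in> l2" "g \<in> l2" "\<And>n. u n \<in> l2"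
    and lim: "(\<lambda>n. l2_norm (\<lambda>v. u n v - g v)) \<longlonglongrightarrow> 0"
  shows "(\<lambda>n. l2_inner h (u n)) \<longlonglongrightarrow> l2_inner h g"
proof (rule LIM_zero_cancel, rule Lim_null_comparison)
  show "\<forall>\<^sub>F n in sequentially. norm (l2_inner h (u n) - l2_inner h g)
      \<le> l2_norm h * l2_norm (\<lambda>v. u n v - g v)"
    using assms l2_cauchy_schwarz[of h "\<lambda>v. u _ v - g v"]
    by (auto simp: l2_inner_diff_right[symmetric] l2_diff)
  show "(\<lambda>n. l2_norm h * l2_norm (\<lambda>v. u n v - g v)) \<longlonglongrightarrow> 0"
    using tendsto_mult_left[OF lim, of "l2_norm h"] by simp
qed

lemma l2_norm_add_power2:
  assumes f: "f \<in> l2" and g: "g \<in> l2"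
  shows "(l2_norm (\<lambda>v. f v + g v))\<^sup>2 = (l2_norm f)\<^sup>2 + 2 * Re (l2_inner f g) + (l2_norm g)\<^sup>2"
proof -
  have "l2_inner (\<lambda>v. f v + g v) (\<lambda>v. f v + g v)
      = l2_inner f f + l2_inner g f + (l2_inner f g + l2_inner g g)"
    by (simp add: l2_inner_add_left l2_inner_add_right f g l2_add)
  then have "Re (l2_inner (\<lambda>v. f v + g v) (\<lambda>v. f v + g v))
      = Re (l2_inner f f) + 2 * Re (l2_inner f g) + Re (l2_inner g g)"
    by (simp add: l2_inner_commute[of g f] del: of_real_power)
  then show ?thesis by (simp only: l2_inner_self f g l2_add Re_complex_of_real)
qed

text \<open>Writing \<open>u n\<close> as \<open>g\<close> plus the error and expanding the square
  leaves a cross term, which vanishes by weak convergence, and the squared error.\<close>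

lemma l2_norm_power2_tendsto:
  assumes g: "g \<in> l2" and u: "\<And>n. u n \<in> l2"
    and lim: "(\<lambda>n. l2_norm (\<lambda>v. u n v - g v)) \<longlonglongrightarrow> 0"
  shows "(\<lambda>n. (l2_norm (u n))\<^sup>2) \<longlonglongrightarrow> (l2_norm g)\<^sup>2"
proof -
  have "(l2_norm (u n))\<^sup>2 = (l2_norm g)\<^sup>2 + 2 * (Re (l2_inner g (u n)) - Re (l2_inner g g))
      + (l2_norm (\<lambda>v. u n v - g v))\<^sup>2" for n
    using l2_norm_add_power2[OF g l2_diff[OF u[of n] g]] by (simp add: l2_inner_diff_right g u)
  moreover have "(\<lambda>n. (l2_norm g)\<^sup>2 + 2 * (Re (l2_inner g (u n)) - Re (l2_inner g g))
      + (l2_norm (\<lambda>v. u n v - g v))\<^sup>2) \<longlonglongrightarrow> (l2_norm g)\<^sup>2 + 2 * (Re (l2_inner g g) - Re (l2_inner g g)) + 0\<^sup>2"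
    by (intro tendsto_intros lim l2_inner_tendsto g u)
  ultimately show ?thesis by simp
qed

lemma
  shows delta_in_l2: "delta x \<in> l2"
    and l2_norm_delta: "l2_norm (delta x) = 1"
    and l2_inner_delta: "l2_inner (delta x) f = f x"
proof -
  \<comment> \<open>Polymorphic in the value type: real values serve the norm, complex values the
    inner product.\<close>
  have *: "((\<lambda>v. if v = x then h v else 0) has_sum h x) UNIV" for h :: "'a \<Rightarrow> 'b :: real_normed_vector"
    using has_sum_finite[of "{x}" "\<lambda>v. if v = x then h v else 0"]
    by (subst has_sum_cong_neutral[where S = UNIV and T = "{x}" and g = "\<lambda>v. if v = x then h v else 0"]) auto
  have eq: "(\<lambda>v. (cmod (delta x v))\<^sup>2) = (\<lambda>v. if v = x then 1 else 0)"
    by (auto simp: delta_def)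
  show "delta x \<in> l2"
    unfolding l2_def mem_Collect_eq eq using *[of "\<lambda>_. 1"] by (rule has_sum_imp_summable)
  show "l2_norm (delta x) = 1"
    unfolding l2_norm_def eq using infsumI[OF *[of "\<lambda>_. 1"]] by simp
  have "(\<lambda>v. cnj (delta x v) * f v) = (\<lambda>v. if v = x then f v else 0)"
    by (auto simp: delta_def)
  then show "l2_inner (delta x) f = f x"
    unfolding l2_inner_def using infsumI[OF *[of f]] by simp
qed

section \<open>Square-integrable functions on a finite measure space\<close>

text \<open>Integrability follows by domination of the product by the sum of the squares. The
  inequality is that of the nonnegative integral applied to absolute values; all integrals there are
  finite, so it descends to the reals.\<close>

lemma integral_cauchy_schwarz:
  fixes f g :: "'a \<Rightarrow> real"
  assumes [measurable]: "f \<in> borel_measurable M" "g \<in> borel_measurable M"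
    and f: "integrable M (\<lambda>x. (f x)\<^sup>2)" and g: "integrable M (\<lambda>x. (g x)\<^sup>2)"
  shows "integrable M (\<lambda>x. f x * g x)"
    and "\<bar>\<integral>x. f x * g x \<partial>M\<bar> \<le> sqrt (\<integral>x. (f x)\<^sup>2 \<partial>M) * sqrt (\<integral>x. (g x)\<^sup>2 \<partial>M)"
proof -
  show fg: "integrable M (\<lambda>x. f x * g x)"
  proof (rule Bochner_Integration.integrable_bound[OF Bochner_Integration.integrable_add[OF f g]])
    show "AE x in M. norm (f x * g x) \<le> norm ((f x)\<^sup>2 + (g x)\<^sup>2)"
    proof (rule AE_I2)
      fix x
      show "norm (f x * g x) \<le> norm ((f x)\<^sup>2 + (g x)\<^sup>2)"
        using sum_squares_bound[of "\<bar>f x\<bar>" "\<bar>g x\<bar>"] mult_nonneg_nonneg[of "\<bar>f x\<bar>" "\<bar>g x\<bar>"]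
        by (simp add: abs_mult del: mult_nonneg_nonneg)
    qed
  qed measurable
  have "(\<integral>\<^sup>+x. ennreal \<bar>f x\<bar> * ennreal \<bar>g x\<bar> \<partial>M)\<^sup>2
      \<le> (\<integral>\<^sup>+x. ennreal \<bar>f x\<bar> ^ 2 \<partial>M) * (\<integral>\<^sup>+x. ennreal \<bar>g x\<bar> ^ 2 \<partial>M)"
    by (rule Cauchy_Schwarz_nn_integral) measurable
  then have "ennreal ((\<integral>x. \<bar>f x * g x\<bar> \<partial>M)\<^sup>2) \<le> ennreal ((\<integral>x. (f x)\<^sup>2 \<partial>M) * (\<integral>x. (g x)\<^sup>2 \<partial>M))"
    using integrable_abs[OF fg] f g
    by (simp add: ennreal_power ennreal_mult'[symmetric] abs_mult nn_integral_eq_integral)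
  then have "(\<integral>x. \<bar>f x * g x\<bar> \<partial>M)\<^sup>2 \<le> (\<integral>x. (f x)\<^sup>2 \<partial>M) * (\<integral>x. (g x)\<^sup>2 \<partial>M)"
    by (subst (asm) ennreal_le_iff) (auto intro!: mult_nonneg_nonneg integral_nonneg)
  then have "(\<integral>x. \<bar>f x * g x\<bar> \<partial>M) \<le> sqrt (\<integral>x. (f x)\<^sup>2 \<partial>M) * sqrt (\<integral>x. (g x)\<^sup>2 \<partial>M)"
    by (metis real_le_rsqrt real_sqrt_mult)
  then show "\<bar>\<integral>x. f x * g x \<partial>M\<bar> \<le> sqrt (\<integral>x. (f x)\<^sup>2 \<partial>M) * sqrt (\<integral>x. (g x)\<^sup>2 \<partial>M)"
    using integral_abs_bound[of M "\<lambda>x. f x * g x"] by linarith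
qed

text \<open>Convergence in \<open>L\<^sup>2\<close> of a finite measure carries over to the first
  two moments. Everything is expressed through the error \<open>d n\<close>, whose products with a
  fixed square-integrable function tend to 0 in mean.\<close>

lemma (in finite_measure) square_integrable_limit:
  fixes s :: "nat \<Rightarrow> 'a \<Rightarrow> real"
  assumes [measurable]: "\<And>n. s n \<in> borel_measurable M" "\<phi> \<in> borel_measurable M"
    and s: "\<And>n. integrable M (\<lambda>t. (s n t)\<^sup>2)"
    and lim: "(\<lambda>n. \<integral>\<^sup>+ t. ennreal ((s n t - \<phi> t)\<^sup>2) \<partial>M) \<longlonglongrightarrow> 0"
  shows "integrable M (\<lambda>t. (\<phi> t)\<^sup>2)"
    and "(\<lambda>n. \<integral>t. s n t \<partial>M) \<longlonglongrightarrow> (\<integral>t. \<phi> t \<partial>M)"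
    and "(\<lambda>n. \<integral>t. (s n t)\<^sup>2 \<partial>M) \<longlonglongrightarrow> (\<integral>t. (\<phi> t)\<^sup>2 \<partial>M)"
proof -
  define d where "d n t = s n t - \<phi> t" for n t
  have [measurable]: "d n \<in> borel_measurable M" for n
    unfolding d_def by measurable
  have "\<forall>\<^sub>F n in sequentially. (\<integral>\<^sup>+ t. ennreal ((s n t - \<phi> t)\<^sup>2) \<partial>M) < \<infinity>"
    using lim by (rule order_tendstoD) simp
  \<comment> \<open>One index with finite error suffices to show that \<open>\<phi>\<close> is
    square-integrable, since \<open>\<phi>\<close> is \<open>s N\<close> minus
    \<open>d N\<close>.\<close>
  then obtain N where N: "(\<integral>\<^sup>+ t. ennreal ((d N t)\<^sup>2) \<partial>M) < \<infinity>"
    unfolding d_def by (auto simp: eventually_sequentially)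
  then have dN: "integrable M (\<lambda>t. (d N t)\<^sup>2)"
    by (intro integrableI_nonneg) auto
  have square_diff: "integrable M (\<lambda>t. (f t - g t)\<^sup>2)"
    if "f \<in> borel_measurable M" "g \<in> borel_measurable M"
      "integrable M (\<lambda>t. (f t)\<^sup>2)" "integrable M (\<lambda>t. (g t)\<^sup>2)" for f g :: "'a \<Rightarrow> real"
    using integral_cauchy_schwarz(1)[OF that] that
    by (simp add: power2_diff mult.assoc)
  show \<phi>: "integrable M (\<lambda>t. (\<phi> t)\<^sup>2)"
    using square_diff[OF _ _ s[of N] dN] by (simp add: d_def)
  have d: "integrable M (\<lambda>t. (d n t)\<^sup>2)" for n
    using square_diff[OF _ _ s[of n] \<phi>] by (simp add: d_def)
  have "(\<lambda>n. ennreal (\<integral>t. (d n t)\<^sup>2 \<partial>M)) \<longlonglongrightarrow> ennreal 0"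
    using lim d by (simp add: d_def[symmetric] nn_integral_eq_integral)
  then have d0: "(\<lambda>n. \<integral>t. (d n t)\<^sup>2 \<partial>M) \<longlonglongrightarrow> 0"
    by (subst (asm) tendsto_ennreal_iff) auto
  \<comment> \<open>This is used twice: for the constant 1, square-integrable because the measure is
    finite, and for \<open>\<phi>\<close> itself. The two cases give the first moment and the cross
    term of the second.\<close>
  have prod0: "(\<lambda>n. \<integral>t. h t * d n t \<partial>M) \<longlonglongrightarrow> 0"
    if h: "h \<in> borel_measurable M" "integrable M (\<lambda>t. (h t)\<^sup>2)" for h
  proof (rule Lim_null_comparison)
    show "\<forall>\<^sub>F n in sequentially. norm (\<integral>t. h t * d n t \<partial>M)
        \<le> sqrt (\<integral>t. (h t)\<^sup>2 \<partial>M) * sqrt (\<integral>t. (d n t)\<^sup>2 \<partial>M)"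
      using integral_cauchy_schwarz(2)[OF h(1) _ h(2) d] by auto
    have "(\<lambda>n. sqrt (\<integral>t. (h t)\<^sup>2 \<partial>M) * sqrt (\<integral>t. (d n t)\<^sup>2 \<partial>M))
        \<longlonglongrightarrow> sqrt (\<integral>t. (h t)\<^sup>2 \<partial>M) * sqrt 0"
      by (intro tendsto_intros d0)
    then show "(\<lambda>n. sqrt (\<integral>t. (h t)\<^sup>2 \<partial>M) * sqrt (\<integral>t. (d n t)\<^sup>2 \<partial>M)) \<longlonglongrightarrow> 0"
      by simp
  qed
  have "(\<integral>t. s n t \<partial>M) = (\<integral>t. \<phi> t \<partial>M) + (\<integral>t. 1 * d n t \<partial>M)" for n
    using square_integrable_imp_integrable[OF _ s[of n]] square_integrable_imp_integrable[OF _ \<phi>]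
    by (simp add: d_def)
  then show "(\<lambda>n. \<integral>t. s n t \<partial>M) \<longlonglongrightarrow> (\<integral>t. \<phi> t \<partial>M)"
    using tendsto_add[OF tendsto_const prod0[of "\<lambda>_. 1"]] by simp
  have "(\<integral>t. (s n t)\<^sup>2 \<partial>M)
      = (\<integral>t. (\<phi> t)\<^sup>2 \<partial>M) + 2 * (\<integral>t. \<phi> t * d n t \<partial>M) + (\<integral>t. (d n t)\<^sup>2 \<partial>M)" for n
  proof -
    have "(\<lambda>t. (s n t)\<^sup>2) = (\<lambda>t. (\<phi> t)\<^sup>2 + 2 * (\<phi> t * d n t) + (d n t)\<^sup>2)"
      by (simp add: d_def fun_eq_iff power2_eq_square algebra_simps)
    then show ?thesis
      using \<phi> d[of n] integral_cauchy_schwarz(1)[OF _ _ \<phi> d[of n]] by simp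
  qed
  moreover have "(\<lambda>n. (\<integral>t. (\<phi> t)\<^sup>2 \<partial>M) + 2 * (\<integral>t. \<phi> t * d n t \<partial>M) + (\<integral>t. (d n t)\<^sup>2 \<partial>M))
      \<longlonglongrightarrow> (\<integral>t. (\<phi> t)\<^sup>2 \<partial>M) + 2 * 0 + 0"
    by (intro tendsto_intros prod0 \<phi> d0) measurable
  ultimately show "(\<lambda>n. \<integral>t. (s n t)\<^sup>2 \<partial>M) \<longlonglongrightarrow> (\<integral>t. (\<phi> t)\<^sup>2 \<partial>M)"
    by simp
qed

section \<open>Moments of spectral distributions\<close>

context
  fixes P :: "real set \<Rightarrow> ('v \<Rightarrow> complex) \<Rightarrow> ('v \<Rightarrow> complex)"
  assumes pvm: "proj_valued_measure P"
begin

section \<open>Inner products of spectral projections\<close>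

lemma pvm_in_l2: "B \<in> sets borel_nonneg \<Longrightarrow> f \<in> l2 \<Longrightarrow> P B f \<in> l2"
  using pvm by (simp add: proj_valued_measure_def orth_projection_def)

text \<open>Symmetry moves \<open>P B\<close> to the right factor, where multiplicativity merges it
  with \<open>P C\<close>. Equal sets then give squared norms, and disjoint sets give
  orthogonality.\<close>

lemma pvm_inner:
  assumes "B \<in> sets borel_nonneg" "C \<in> sets borel_nonneg" "f \<in> l2"
  shows "l2_inner (P B f) (P C f) = l2_inner f (P (B \<inter> C) f)"
  using assms pvm pvm_in_l2[of C f] by (simp add: proj_valued_measure_def orth_projection_def)

lemma pvm_inner_self:
  assumes "B \<in> sets borel_nonneg" "f \<in> l2"
  shows "l2_inner f (P B f) = of_real ((l2_norm (P B f))\<^sup>2)"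
  using pvm_inner[of B B f] assms by (simp add: l2_inner_self pvm_in_l2)

lemma pvm_inner_disjoint:
  assumes "B \<in> sets borel_nonneg" "C \<in> sets borel_nonneg" "f \<in> l2" "B \<inter> C = {}"
  shows "l2_inner (P B f) (P C f) = 0"
  using pvm_inner[of B C f] assms pvm by (simp add: proj_valued_measure_def l2_inner_def)

text \<open>Pairing the strongly convergent partial sums with \<open>f\<close> gives a scalar
  series, and each \<open>l2_inner f (P B f)\<close> is a squared norm. This is the countable
  additivity of the spectral distribution.\<close>

lemma pvm_sums:
  assumes "range B \<subseteq> sets borel_nonneg" "disjoint_family B" and f: "f \<in> l2"
  shows "(\<lambda>i. (l2_norm (P (B i) f))\<^sup>2) sums (l2_norm (P (\<Union>i. B i) f))\<^sup>2"
proof -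
  have B: "B i \<in> sets borel_nonneg" for i using assms(1) by auto
  then have U: "(\<Union>i. B i) \<in> sets borel_nonneg" by (intro sets.countable_UN) auto
  have "(\<lambda>n. l2_norm (\<lambda>v. (\<Sum>i<n. P (B i) f v) - P (\<Union>i. B i) f v)) \<longlonglongrightarrow> 0"
    using pvm assms by (simp add: proj_valued_measure_def)
  then have "(\<lambda>n. l2_inner f (\<lambda>v. \<Sum>i<n. P (B i) f v)) \<longlonglongrightarrow> l2_inner f (P (\<Union>i. B i) f)"
    using f B U by (intro l2_inner_tendsto l2_sum pvm_in_l2)
  then have "(\<lambda>n. complex_of_real (\<Sum>i<n. (l2_norm (P (B i) f))\<^sup>2))
      \<longlonglongrightarrow> of_real ((l2_norm (P (\<Union>i. B i) f))\<^sup>2)"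
    using f B U by (simp add: l2_inner_sum_right pvm_in_l2 pvm_inner_self)
  then show ?thesis
    unfolding sums_def by (simp only: tendsto_of_real_iff)
qed

section \<open>Spectral distributions as finite measures\<close>

lemma space_spectral_dist [simp]: "space (spectral_dist P f) = {0..}"
  by (simp add: spectral_dist_def space_measure_of_conv)

lemma sets_spectral_dist [simp, measurable_cong]:
  "sets (spectral_dist P f) = sets borel_nonneg"
  using sets.sets_measure_of_eq[of borel_nonneg] by (simp add: spectral_dist_def space_restrict_space)

text \<open>\<open>measure_of\<close> returns the zero measure when its set function is not a
  measure, so positivity and countable additivity have to be established before the values can be
  read off.\<close>

lemma emeasure_spectral_dist:
  assumes f: "f \<in> l2" and "B \<in> sets borel_nonneg"
  shows "emeasure (spectral_dist P f) B = ennreal ((l2_norm (P B f))\<^sup>2)"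
  unfolding spectral_dist_def
proof (rule emeasure_measure_of_sigma)
  show "sigma_algebra {0..} (sets borel_nonneg)"
    using sets.sigma_algebra_axioms[of borel_nonneg] by (simp add: space_restrict_space)
  show "positive (sets borel_nonneg) (\<lambda>B. ennreal ((l2_norm (P B f))\<^sup>2))"
    using pvm f by (simp add: positive_def proj_valued_measure_def l2_norm_def)
  show "countably_additive (sets borel_nonneg) (\<lambda>B. ennreal ((l2_norm (P B f))\<^sup>2))"
  proof (rule countably_additiveI)
    fix B :: "nat \<Rightarrow> real set"
    assume "range B \<subseteq> sets borel_nonneg" "disjoint_family B"
    then show "(\<Sum>i. ennreal ((l2_norm (P (B i) f))\<^sup>2)) = ennreal ((l2_norm (P (\<Union>i. B i) f))\<^sup>2)"
      using pvm_sums[of B f] f by (intro sums_unique[symmetric]) simp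
  qed
qed fact

lemma finite_measure_spectral_dist: "f \<in> l2 \<Longrightarrow> finite_measure (spectral_dist P f)"
  by (rule finite_measureI)
    (simp add: emeasure_spectral_dist sets_restrict_space_iff)

lemma measure_spectral_dist:
  "f \<in> l2 \<Longrightarrow> B \<in> sets borel_nonneg \<Longrightarrow> measure (spectral_dist P f) B = (l2_norm (P B f))\<^sup>2"
  by (simp add: measure_def emeasure_spectral_dist)

text \<open>The function is a finite combination of indicators of the level sets of
  \<open>s\<close>. The free function \<open>\<psi>\<close> lets one statement cover both
  \<open>s\<close> and its square.\<close>

lemma
  assumes s: "simple_function borel_nonneg s" and f: "f \<in> l2"
  shows integrable_simple_spectral_dist: "integrable (spectral_dist P f) (\<lambda>t. \<psi> (s t) :: real)"
    and integral_simple_spectral_dist: "(\<integral>t. \<psi> (s t) \<partial>spectral_dist P f)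
      = (\<Sum>a\<in>s ` {0..}. \<psi> a * (l2_norm (P (s -` {a} \<inter> {0..}) f))\<^sup>2)"
proof -
  interpret finite_measure "spectral_dist P f"
    using f by (rule finite_measure_spectral_dist)
  have fin: "finite (s ` {0..})"
    using s by (simp add: simple_function_def space_restrict_space)
  have B: "s -` {a} \<inter> {0..} \<in> sets borel_nonneg" for a
    using simple_functionD(2)[OF s, of "{a}"] by (simp add: space_restrict_space)
  \<comment> \<open>The level sets partition the half-line, so exactly one summand survives at each
    point.\<close>
  have eq: "\<psi> (s t) = (\<Sum>a\<in>s ` {0..}. \<psi> a * indicator (s -` {a} \<inter> {0..}) t)" if "t \<in> {0..}" for t
  proof -
    have "(\<Sum>a\<in>s ` {0..}. \<psi> a * indicator (s -` {a} \<inter> {0..}) t) = (\<Sum>a\<in>s ` {0..}. if s t = a then \<psi> a else 0)"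
      using that by (intro sum.cong) (auto simp: indicator_def)
    with fin that show ?thesis by simp
  qed
  have "integrable (spectral_dist P f) (\<lambda>t. \<Sum>a\<in>s ` {0..}. \<psi> a * indicator (s -` {a} \<inter> {0..}) t)"
    using B by (intro Bochner_Integration.integrable_sum integrable_mult_right integrable_real_indicator)
      (auto simp: emeasure_spectral_dist f)
  then show "integrable (spectral_dist P f) (\<lambda>t. \<psi> (s t))"
    by (rule Bochner_Integration.integrable_cong[OF refl, THEN iffD2, rotated]) (simp add: eq)
  have "(\<integral>t. \<psi> (s t) \<partial>spectral_dist P f)
      = (\<integral>t. (\<Sum>a\<in>s ` {0..}. \<psi> a * indicator (s -` {a} \<inter> {0..}) t) \<partial>spectral_dist P f)"
    by (rule Bochner_Integration.integral_cong[OF refl]) (simp add: eq)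
  also have "\<dots> = (\<Sum>a\<in>s ` {0..}. \<psi> a * (l2_norm (P (s -` {a} \<inter> {0..}) f))\<^sup>2)"
    using B f fin
    by (subst Bochner_Integration.integral_sum)
      (auto simp: measure_spectral_dist emeasure_spectral_dist Int_absorb2 intro!: integrable_real_indicator)
  finally show "(\<integral>t. \<psi> (s t) \<partial>spectral_dist P f)
      = (\<Sum>a\<in>s ` {0..}. \<psi> a * (l2_norm (P (s -` {a} \<inter> {0..}) f))\<^sup>2)" .
qed

text \<open>The isometry for simple functions: projections onto distinct level sets have orthogonal
  ranges, so the double sum for the squared norm reduces to its diagonal, which is the integral of
  the square.\<close>

lemma
  assumes s: "simple_function borel_nonneg s" and f: "f \<in> l2"
  shows simple_spectral_integral_in_l2: "simple_spectral_integral P s f \<in> l2"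
    and inner_simple_spectral_integral: "l2_inner f (simple_spectral_integral P s f)
      = of_real (\<integral>t. s t \<partial>spectral_dist P f)"
    and norm_simple_spectral_integral: "(l2_norm (simple_spectral_integral P s f))\<^sup>2
      = (\<integral>t. (s t)\<^sup>2 \<partial>spectral_dist P f)"
proof -
  define B where "B a = s -` {a} \<inter> {0..}" for a
  have B: "B a \<in> sets borel_nonneg" for a
    using simple_functionD(2)[OF s, of "{a}"] by (simp add: space_restrict_space B_def)
  have fin: "finite (s ` {0..})"
    using s by (simp add: simple_function_def space_restrict_space)
  note l2 = l2_sum l2_scale pvm_in_l2 B f
  have S: "simple_spectral_integral P s f = (\<lambda>v. \<Sum>a\<in>s ` {0..}. of_real a * P (B a) f v)"
    by (simp add: simple_spectral_integral_def B_def)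
  show in_l2: "simple_spectral_integral P s f \<in> l2"
    unfolding S by (intro l2)
  show "l2_inner f (simple_spectral_integral P s f) = of_real (\<integral>t. s t \<partial>spectral_dist P f)"
    unfolding S integral_simple_spectral_dist[OF s f, of "\<lambda>a. a"]
    by (simp add: l2_inner_sum_right l2_inner_scale_right pvm_inner_self l2 flip: B_def)
  have "l2_inner (simple_spectral_integral P s f) (simple_spectral_integral P s f)
      = (\<Sum>a\<in>s ` {0..}. \<Sum>b\<in>s ` {0..}. of_real a * (of_real b * l2_inner (P (B b) f) (P (B a) f)))"
    unfolding S
    by (simp add: l2_inner_sum_right l2_inner_sum_left l2_inner_scale_right l2_inner_scale_left l2 sum_distrib_left)
  also have "\<dots> = (\<Sum>a\<in>s ` {0..}. \<Sum>b\<in>s ` {0..}. if a = b then of_real (a\<^sup>2 * (l2_norm (P (B a) f))\<^sup>2) else 0)"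
  proof (intro sum.cong refl)
    fix a b
    have "a \<noteq> b \<Longrightarrow> l2_inner (P (B b) f) (P (B a) f) = 0"
      using B f by (intro pvm_inner_disjoint) (auto simp: B_def)
    then show "of_real a * (of_real b * l2_inner (P (B b) f) (P (B a) f))
        = (if a = b then of_real (a\<^sup>2 * (l2_norm (P (B a) f))\<^sup>2) else 0)"
      using B f by (simp add: l2_inner_self pvm_in_l2 power2_eq_square)
  qed
  also have "\<dots> = of_real (\<integral>t. (s t)\<^sup>2 \<partial>spectral_dist P f)"
    using fin by (simp add: integral_simple_spectral_dist[OF s f, of "\<lambda>a. a\<^sup>2"] B_def)
  finally show "(l2_norm (simple_spectral_integral P s f))\<^sup>2 = (\<integral>t. (s t)\<^sup>2 \<partial>spectral_dist P f)"
    by (simp only: l2_inner_self[OF in_l2] of_real_eq_iff)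
qed

text \<open>The approximating sequence in \<open>spectral_integral\<close> converges in two senses
  at once: as functions in \<open>L\<^sup>2\<close> of the spectral distribution, and after
  application to \<open>f\<close> in \<open>l2\<close>. The identities for simple functions
  therefore have limits on both sides, and limits are unique.\<close>

lemma spectral_integral_moments:
  assumes fg: "(f, g) \<in> spectral_integral P \<phi>"
    and \<phi>: "\<phi> \<in> borel_measurable borel_nonneg"
  shows "integrable (spectral_dist P f) (\<lambda>t. (\<phi> t)\<^sup>2)"
    and "l2_inner f g = of_real (\<integral>t. \<phi> t \<partial>spectral_dist P f)"
    and "(l2_norm g)\<^sup>2 = (\<integral>t. (\<phi> t)\<^sup>2 \<partial>spectral_dist P f)"
proof -
  from fg obtain s where f: "f \<in> l2" and g: "g \<in> l2"
    and s: "\<And>n::nat. simple_function borel_nonneg (s n)"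
    and lim: "(\<lambda>n. \<integral>\<^sup>+ t. ennreal ((s n t - \<phi> t)\<^sup>2) \<partial>spectral_dist P f) \<longlonglongrightarrow> 0"
    and lim_l2: "(\<lambda>n. l2_norm (\<lambda>v. simple_spectral_integral P (s n) f v - g v)) \<longlonglongrightarrow> 0"
    unfolding spectral_integral_def by auto
  interpret finite_measure "spectral_dist P f"
    using f by (rule finite_measure_spectral_dist)
  have meas: "s n \<in> borel_measurable (spectral_dist P f)" "\<phi> \<in> borel_measurable (spectral_dist P f)" for n
    using borel_measurable_simple_function[OF s[of n]] \<phi>
    by (simp_all add: measurable_cong_sets[OF sets_spectral_dist refl])
  note limits = square_integrable_limit[OF meas integrable_simple_spectral_dist[OF s f] lim]
  show "integrable (spectral_dist P f) (\<lambda>t. (\<phi> t)\<^sup>2)"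
    by (rule limits)
  have "(\<lambda>n. l2_inner f (simple_spectral_integral P (s n) f)) \<longlonglongrightarrow> l2_inner f g"
    using lim_l2 f g s by (intro l2_inner_tendsto simple_spectral_integral_in_l2)
  moreover have "(\<lambda>n. l2_inner f (simple_spectral_integral P (s n) f))
      \<longlonglongrightarrow> of_real (\<integral>t. \<phi> t \<partial>spectral_dist P f)"
    using limits(2) by (simp add: inner_simple_spectral_integral[OF s f] tendsto_of_real)
  ultimately show "l2_inner f g = of_real (\<integral>t. \<phi> t \<partial>spectral_dist P f)"
    by (rule LIMSEQ_unique)
  have "(\<lambda>n. (l2_norm (simple_spectral_integral P (s n) f))\<^sup>2) \<longlonglongrightarrow> (l2_norm g)\<^sup>2"
    using lim_l2 f g s by (intro l2_norm_power2_tendsto simple_spectral_integral_in_l2)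
  then show "(l2_norm g)\<^sup>2 = (\<integral>t. (\<phi> t)\<^sup>2 \<partial>spectral_dist P f)"
    using limits(3) by (intro LIMSEQ_unique) (simp_all add: norm_simple_spectral_integral[OF s f])
qed

end

text \<open>The spectral integral of the identity function is \<open>T\<close>, so
  \<open>(f, g)\<close> yields the mean and the second moment. A unit vector has a probability
  measure as spectral distribution, hence the variance is the second moment minus the squared
  mean.\<close>

lemma spectral_measure_moments:
  assumes P: "spectral_measure_of T P" and fg: "(f, g) \<in> T"
    and norm_f: "l2_norm f = 1" and inner: "l2_inner f g = of_real m"
  shows "(\<integral>\<^sup>+ t. ennreal t \<partial>spectral_dist P f) = ennreal m"
    and "(\<integral>\<^sup>+ t. ennreal (t\<^sup>2) \<partial>spectral_dist P f) = ennreal ((l2_norm g)\<^sup>2)"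
    and "covariance (spectral_dist P f) = ennreal ((l2_norm g)\<^sup>2 - m\<^sup>2)"
proof -
  let ?\<mu> = "spectral_dist P f"
  from P fg have pvm: "proj_valued_measure P" and fg': "(f, g) \<in> spectral_integral P (\<lambda>t. t)"
    by (auto simp: spectral_measure_of_def)
  then have f: "f \<in> l2" by (auto simp: spectral_integral_def)
  have id: "(\<lambda>t. t) \<in> borel_measurable borel_nonneg"
    by (rule measurable_restrict_space1) simp
  interpret finite_measure ?\<mu>
    using pvm f by (rule finite_measure_spectral_dist)
  have [measurable]: "(\<lambda>t. t) \<in> borel_measurable ?\<mu>"
    using id by (simp add: measurable_cong_sets[OF sets_spectral_dist[OF pvm] refl])
  note moments = spectral_integral_moments[OF pvm fg' id]
  \<comment> \<open>On a finite measure space square integrability gives integrability, which makes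
    the Bochner mean in \<open>covariance\<close> agree with the nonnegative integral.\<close>
  have int: "integrable ?\<mu> (\<lambda>t. t)"
    using square_integrable_imp_integrable[OF _ moments(1)] by simp
  have m: "(\<integral>t. t \<partial>?\<mu>) = m"
    using moments(2) inner by simp
  have nonneg: "AE t in ?\<mu>. 0 \<le> t"
    by (rule AE_I2) (simp add: space_spectral_dist[OF pvm])
  show "(\<integral>\<^sup>+ t. ennreal t \<partial>?\<mu>) = ennreal m"
    using nn_integral_eq_integral[OF int nonneg] m by simp
  show "(\<integral>\<^sup>+ t. ennreal (t\<^sup>2) \<partial>?\<mu>) = ennreal ((l2_norm g)\<^sup>2)"
    using nn_integral_eq_integral[OF moments(1)] moments(3) by simp
  \<comment> \<open>\<open>P {0..}\<close> fixes \<open>f\<close>, so the total mass is the squared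
    norm of \<open>f\<close>.\<close>
  have one: "measure ?\<mu> {0..} = 1"
    using pvm f norm_f by (subst measure_spectral_dist)
      (auto simp: sets_restrict_space_iff proj_valued_measure_def)
  have "(\<integral>t. (t - m)\<^sup>2 \<partial>?\<mu>) = (\<integral>t. t\<^sup>2 - 2 * m * t + m\<^sup>2 \<partial>?\<mu>)"
    by (intro Bochner_Integration.integral_cong refl) (simp add: power2_diff)
  also have "\<dots> = (\<integral>t. t\<^sup>2 \<partial>?\<mu>) - 2 * m * (\<integral>t. t \<partial>?\<mu>) + measure ?\<mu> (space ?\<mu>) * m\<^sup>2"
    using int moments(1) by (simp add: mult.assoc)
  also have "\<dots> = (l2_norm g)\<^sup>2 - m\<^sup>2"
    unfolding m moments(3) space_spectral_dist[OF pvm] one by (simp add: power2_eq_square)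
  finally have variance: "(\<integral>t. (t - m)\<^sup>2 \<partial>?\<mu>) = (l2_norm g)\<^sup>2 - m\<^sup>2" .
  have "integrable ?\<mu> (\<lambda>t. (t - m)\<^sup>2)"
    using int moments(1) by (simp add: power2_diff)
  from nn_integral_eq_integral[OF this] show "covariance ?\<mu> = ennreal ((l2_norm g)\<^sup>2 - m\<^sup>2)"
    unfolding covariance_def m variance[symmetric] by simp
qed

section \<open>Point masses in the energy space\<close>

text \<open>Only edges meeting \<open>x\<close> contribute. Those leaving and those entering
  \<open>x\<close> form disjoint sets because there are no loops, and symmetry gives them equal
  sums. The doubling cancels the factor 1/2 in the energy.\<close>

lemma (in infinite_network) has_sum_edges_at_vertex:
  fixes h :: "'v \<times> 'v \<Rightarrow> 'b :: {topological_comm_monoid_add, t2_space}"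
  assumes sym_h: "\<And>u v. (u, v) \<in> E \<Longrightarrow> h (u, v) = h (v, u)"
    and zero: "\<And>u v. (u, v) \<in> E \<Longrightarrow> u \<noteq> x \<Longrightarrow> v \<noteq> x \<Longrightarrow> h (u, v) = 0"
    and sum: "((\<lambda>v. h (x, v)) has_sum S) (neighbours E x)"
  shows "(h has_sum S + S) E"
proof -
  let ?N = "neighbours E x"
  have N: "(x, v) \<in> E" "(v, x) \<in> E" "v \<noteq> x" if "v \<in> ?N" for v
    using that sym_edges irrefl_edges by (auto simp: neighbours_def dest: symD irreflD)
  have "(h has_sum S) (Pair x ` ?N)"
    using sum by (subst has_sum_reindex) (auto simp: inj_on_def o_def)
  moreover have "((\<lambda>v. h (v, x)) has_sum S) ?N"
    by (rule has_sum_cong[THEN iffD1, OF _ sum]) (use N sym_h in auto)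
  then have "(h has_sum S) ((\<lambda>v. (v, x)) ` ?N)"
    by (subst has_sum_reindex) (auto simp: inj_on_def o_def)
  ultimately have "(h has_sum S + S) (Pair x ` ?N \<union> (\<lambda>v. (v, x)) ` ?N)"
    using N by (intro has_sum_Un_disjoint) auto
  then show ?thesis
  proof (rule has_sum_cong_neutral[THEN iffD1, rotated -1])
    fix e assume "e \<in> E - (Pair x ` ?N \<union> (\<lambda>v. (v, x)) ` ?N)"
    then show "h e = 0"
      using sym_edges by (cases e) (auto simp: neighbours_def intro!: zero dest: symD)
  qed (use N in auto)
qed

lemma finite_energy_class_of:
  "finite_energy E c (class_of f) \<longleftrightarrow> (\<lambda>(x, y). c x y * (cmod (f x - f y))\<^sup>2) summable_on E"
  by transfer simp

lemma energy_norm_class_of: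
  "energy_norm E c (class_of f) = sqrt (1 / 2 * (\<Sum>\<^sub>\<infinity>(x, y)\<in>E. c x y * (cmod (f x - f y))\<^sup>2))"
  by transfer simp

lemma energy_inner_class_of:
  "energy_inner E c (class_of f) (class_of g)
    = 1 / 2 * (\<Sum>\<^sub>\<infinity>(x, y)\<in>E. of_real (c x y) * cnj (f x - f y) * (g x - g y))"
  by transfer simp

text \<open>This identifies the second component of a pair in \<open>op_A\<close> as the class of
  the first.\<close>

lemma class_of_sum:
  "(\<Sum>y\<in>F. scale_mod_const (a y) (class_of (f y))) = class_of (\<lambda>v. \<Sum>y\<in>F. a y * f y v)"
proof -
  have zero: "0 = class_of (\<lambda>v. 0)"
    by transfer auto
  have add: "scale_mod_const b (class_of g) + class_of h = class_of (\<lambda>v. b * g v + h v)" for b g h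
    by transfer auto
  show ?thesis
    by (induction F rule: infinite_finite_induct) (simp_all add: zero add)
qed

lemma energy_norm_zero: "energy_norm E c 0 = 0"
  by transfer (simp add: case_prod_unfold)

context infinite_network
begin

section \<open>Total conductance and the energy of a point mass\<close>

lemma conductance_nonneg: "y \<in> neighbours E x \<Longrightarrow> 0 \<le> c x y"
  using conductance_pos[of x y] by (simp add: neighbours_def)

lemma not_neighbour_self: "x \<notin> neighbours E x"
  using irrefl_edges by (auto simp: neighbours_def irrefl_def)

lemma total_conductance_finite_iff:
  "total_conductance E c x < \<infinity> \<longleftrightarrow> c x summable_on neighbours E x"
  unfolding total_conductance_def
  using summable_on_if_infsum_ennreal_finite[of "c x" "neighbours E x"] conductance_nonneg
  by (auto simp: infsum_ennreal)

lemma total_conductance_eq: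
  "c x summable_on neighbours E x \<Longrightarrow> total_conductance E c x = ennreal (infsum (c x) (neighbours E x))"
  unfolding total_conductance_def by (rule infsum_ennreal) (auto intro: conductance_nonneg)

lemma energy_delta_at_neighbour:
  "y \<in> neighbours E x \<Longrightarrow> c x y * (cmod (delta x x - delta x y))\<^sup>2 = c x y"
  using not_neighbour_self[of x] by (auto simp: delta_def)

lemma has_sum_energy_delta:
  assumes "c x summable_on neighbours E x"
  shows "((\<lambda>(u, v). c u v * (cmod (delta x u - delta x v))\<^sup>2)
    has_sum 2 * infsum (c x) (neighbours E x)) E"
proof -
  have "((\<lambda>(u, v). c u v * (cmod (delta x u - delta x v))\<^sup>2)
      has_sum infsum (c x) (neighbours E x) + infsum (c x) (neighbours E x)) E"
  proof (rule has_sum_edges_at_vertex)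
    show "((\<lambda>v. case (x, v) of (u, v) \<Rightarrow> c u v * (cmod (delta x u - delta x v))\<^sup>2)
        has_sum infsum (c x) (neighbours E x)) (neighbours E x)"
      using has_sum_infsum[OF assms]
      by (rule has_sum_cong[THEN iffD1, rotated]) (simp add: energy_delta_at_neighbour)
  qed (auto simp: norm_minus_commute delta_def dest: conductance_sym)
  then show ?thesis by simp
qed

lemma delta_in_energy_space_iff:
  "class_of (delta x) \<in> energy_space E c \<longleftrightarrow> c x summable_on neighbours E x"
proof
  assume "class_of (delta x) \<in> energy_space E c"
  then have "(\<lambda>(u, v). c u v * (cmod (delta x u - delta x v))\<^sup>2) summable_on E"
    by (simp add: energy_space_def finite_energy_class_of)
  \<comment> \<open>Restricting to the edges that leave \<open>x\<close> turns the energy sum into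
    the sum of the conductances at \<open>x\<close>.\<close>
  then have "(\<lambda>(u, v). c u v * (cmod (delta x u - delta x v))\<^sup>2) summable_on Pair x ` neighbours E x"
    by (rule summable_on_subset_banach) (auto simp: neighbours_def)
  then have "(\<lambda>v. c x v * (cmod (delta x x - delta x v))\<^sup>2) summable_on neighbours E x"
    by (subst (asm) summable_on_reindex) (auto simp: inj_on_def o_def)
  then show "c x summable_on neighbours E x"
    by (rule summable_on_cong[THEN iffD1, rotated]) (simp add: energy_delta_at_neighbour)
next
  assume "c x summable_on neighbours E x"
  then show "class_of (delta x) \<in> energy_space E c"
    using has_sum_imp_summable[OF has_sum_energy_delta]
    by (simp add: energy_space_def finite_energy_class_of)
qed

lemma energy_norm_delta:
  assumes "c x summable_on neighbours E x"
  shows "(energy_norm E c (class_of (delta x)))\<^sup>2 = infsum (c x) (neighbours E x)"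
  using infsumI[OF has_sum_energy_delta[OF assms]]
    infsum_nonneg[of "neighbours E x" "c x"] conductance_nonneg
  by (simp add: energy_norm_class_of)

text \<open>The value at \<open>v\<close> is the sum over neighbours \<open>u\<close> of
  \<open>c v u * (delta x v - delta x u)\<close>. Since \<open>infsum\<close> is 0 for a divergent
  real sum, the entry at \<open>x\<close> is the total conductance only when that is finite.\<close>

definition laplace_delta :: "'v \<Rightarrow> 'v \<Rightarrow> complex" where
  "laplace_delta x v =
    (if v = x then of_real (infsum (c x) (neighbours E x))
     else if v \<in> neighbours E x then - of_real (c x v) else 0)"

text \<open>A bounded \<open>f\<close> keeps \<open>c x v * f v\<close> summable, so the sum splits
  into \<open>c(x) f(x)\<close> minus the weighted sum over neighbours. The same two pieces make up
  the inner product. Boundedness is a form that fits both finite combinations of point masses and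
  \<open>laplace_delta x\<close> itself.\<close>

lemma has_sum_laplace_delta_inner:
  assumes c: "c x summable_on neighbours E x"
    and f: "\<And>v. cmod (f v) \<le> K"
  shows "((\<lambda>v. of_real (c x v) * (f x - f v)) has_sum l2_inner (laplace_delta x) f) (neighbours E x)"
proof -
  let ?N = "neighbours E x"
  have "(\<lambda>v. of_real (c x v) * f v) summable_on ?N"
  proof (rule abs_summable_summable, rule summable_on_comparison_test)
    show "(\<lambda>v. c x v * K) summable_on ?N"
      by (rule summable_on_cmult_left[OF c])
    show "norm (of_real (c x v) * f v) \<le> c x v * K" if "v \<in> ?N" for v
      using conductance_nonneg[OF that] f[of v] by (simp add: norm_mult mult_left_mono)
  qed simp
  then obtain S where S: "((\<lambda>v. of_real (c x v) * f v) has_sum S) ?N"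
    by (auto simp: summable_on_def)
  let ?C = "infsum (c x) ?N"
  have "((\<lambda>v. of_real (c x v) * f x) has_sum of_real ?C * f x) ?N"
    by (intro has_sum_cmult_left has_sum_of_real has_sum_infsum c)
  from has_sum_add[OF this has_sum_uminusI[OF S]]
  have lhs: "((\<lambda>v. of_real (c x v) * (f x - f v)) has_sum of_real ?C * f x - S) ?N"
    by (simp add: right_diff_distrib)
  \<comment> \<open>\<open>laplace_delta x\<close> is supported on \<open>x\<close> and its
    neighbours, and \<open>x\<close> is not its own neighbour, so the two parts are
    disjoint.\<close>
  have "((\<lambda>v. cnj (laplace_delta x v) * f v) has_sum of_real ?C * f x + - S) ({x} \<union> ?N)"
  proof (rule has_sum_Un_disjoint)
    show "((\<lambda>v. cnj (laplace_delta x v) * f v) has_sum of_real ?C * f x) {x}"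
      using has_sum_finite[of "{x}" "\<lambda>v. cnj (laplace_delta x v) * f v"]
      by (simp add: laplace_delta_def)
    have "((\<lambda>v. - (of_real (c x v) * f v)) has_sum - S) ?N"
      using S by (rule has_sum_uminusI)
    then show "((\<lambda>v. cnj (laplace_delta x v) * f v) has_sum - S) ?N"
      by (rule has_sum_cong[THEN iffD1, rotated])
        (use not_neighbour_self[of x] in \<open>auto simp: laplace_delta_def\<close>)
  qed (use not_neighbour_self[of x] in auto)
  then have "((\<lambda>v. cnj (laplace_delta x v) * f v) has_sum of_real ?C * f x - S) UNIV"
    by (subst has_sum_cong_neutral[where T = "{x} \<union> ?N" and g = "\<lambda>v. cnj (laplace_delta x v) * f v"])
      (auto simp: laplace_delta_def)
  then have "l2_inner (laplace_delta x) f = of_real ?C * f x - S"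
    unfolding l2_inner_def by (rule infsumI)
  with lhs show ?thesis by simp
qed

text \<open>A discrete Green identity: the difference of values of \<open>delta x\<close> vanishes
  on edges away from \<open>x\<close>, and the edges at \<open>x\<close> give the preceding sum once
  per orientation.\<close>

lemma energy_inner_delta:
  assumes c: "c x summable_on neighbours E x"
    and f: "\<And>v. cmod (f v) \<le> K"
  shows "energy_inner E c (class_of (delta x)) (class_of f) = l2_inner (laplace_delta x) f"
proof -
  let ?S = "l2_inner (laplace_delta x) f"
  have "((\<lambda>(u, v). of_real (c u v) * cnj (delta x u - delta x v) * (f u - f v)) has_sum ?S + ?S) E"
  proof (rule has_sum_edges_at_vertex)
    show "((\<lambda>v. case (x, v) of (u, v) \<Rightarrow> of_real (c u v) * cnj (delta x u - delta x v) * (f u - f v))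
        has_sum ?S) (neighbours E x)"
      using has_sum_laplace_delta_inner[OF c f]
      by (rule has_sum_cong[THEN iffD1, rotated])
        (use not_neighbour_self[of x] in \<open>auto simp: delta_def\<close>)
  qed (auto simp: delta_def right_diff_distrib dest: conductance_sym)
  then show ?thesis
    by (simp add: energy_inner_class_of infsumI)
qed

lemma laplace_delta_in_l2:
  assumes c: "c x summable_on neighbours E x"
  shows "laplace_delta x \<in> l2"
proof -
  let ?N = "neighbours E x"
  have "(\<lambda>v. (cmod (laplace_delta x v))\<^sup>2) summable_on {x} \<union> ?N"
  proof (rule summable_on_Un_disjoint)
    have "(\<lambda>v. (c x v)\<^sup>2) summable_on ?N"
      using c by (intro summable_on_power2 conductance_nonneg)
    then show "(\<lambda>v. (cmod (laplace_delta x v))\<^sup>2) summable_on ?N"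
      by (rule summable_on_cong[THEN iffD1, rotated])
        (use not_neighbour_self[of x] in \<open>auto simp: laplace_delta_def\<close>)
  qed (use not_neighbour_self[of x] in auto)
  then show ?thesis
    unfolding l2_def mem_Collect_eq
    by (rule summable_on_cong_neutral[THEN iffD1, rotated -1]) (auto simp: laplace_delta_def)
qed

text \<open>The inner product formula is applied to \<open>laplace_delta x\<close> itself, which is
  bounded by the total conductance \<open>?C\<close>. Its difference between \<open>x\<close> and a
  neighbour \<open>v\<close> is \<open>?C + c x v\<close>, so the squared norm is the sum of
  \<open>c x v * (?C + c x v)\<close>.\<close>

lemma l2_norm_laplace_delta:
  assumes c: "c x summable_on neighbours E x"
  shows "(l2_norm (laplace_delta x))\<^sup>2
    = (infsum (c x) (neighbours E x))\<^sup>2 + (\<Sum>\<^sub>\<infinity>y\<in>neighbours E x. (c x y)\<^sup>2)"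
proof -
  let ?N = "neighbours E x" and ?C = "infsum (c x) (neighbours E x)"
  have "c x v \<le> ?C" if "v \<in> ?N" for v
    using that c conductance_nonneg finite_sum_le_infsum[of "c x" ?N "{v}"] by simp
  then have "cmod (laplace_delta x v) \<le> ?C" for v
    using conductance_nonneg[of v x] infsum_nonneg[of ?N "c x"] conductance_nonneg
    by (auto simp: laplace_delta_def)
  from has_sum_laplace_delta_inner[OF c this]
  have "((\<lambda>v. complex_of_real (c x v * (?C + c x v))) has_sum of_real ((l2_norm (laplace_delta x))\<^sup>2)) ?N"
    unfolding l2_inner_self[OF laplace_delta_in_l2[OF c], symmetric]
    by (rule has_sum_cong[THEN iffD1, rotated])
      (use not_neighbour_self[of x] in \<open>auto simp: laplace_delta_def\<close>)
  then have "((\<lambda>v. c x v * (?C + c x v)) has_sum (l2_norm (laplace_delta x))\<^sup>2) ?N"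
    by (simp only: has_sum_of_real_iff)
  moreover have "((\<lambda>v. c x v * ?C + (c x v)\<^sup>2) has_sum ?C * ?C + (\<Sum>\<^sub>\<infinity>y\<in>?N. (c x y)\<^sup>2)) ?N"
    using c by (intro has_sum_add has_sum_cmult_left has_sum_infsum summable_on_power2 conductance_nonneg)
  ultimately show ?thesis
    by (simp add: distrib_left power2_eq_square has_sum_unique)
qed

text \<open>The class of \<open>delta x\<close> is the intermediate element of the composition:
  \<open>A\<close> sends \<open>delta x\<close> to it, and the Green identity shows that the adjoint
  sends it on to \<open>laplace_delta x\<close>.\<close>

lemma delta_laplace_in_AstarA:
  assumes c: "c x summable_on neighbours E x"
  shows "(delta x, laplace_delta x) \<in> op_AstarA E c"
  unfolding op_AstarA_def
proof (rule relcompI)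
  have "delta x = (\<lambda>v. \<Sum>y\<in>{x}. 1 * delta y v)"
    "class_of (delta x) = (\<Sum>y\<in>{x}. scale_mod_const 1 (class_of (delta y)))"
    by (simp_all only: class_of_sum) simp_all
  then have "(delta x, class_of (delta x)) \<in> op_A"
    unfolding op_A_def by (intro CollectI exI[of _ "{x}"] exI[of _ "\<lambda>_. 1"]) simp
  \<comment> \<open>A pair in the graph is the limit of the constant sequence at that pair.\<close>
  then show "(delta x, class_of (delta x)) \<in> op_closure E c op_A"
    unfolding op_closure_def
    by (auto simp: delta_in_l2 delta_in_energy_space_iff c energy_norm_zero l2_norm_def
        intro!: exI[of _ "\<lambda>_. delta x"] exI[of _ "\<lambda>_. class_of (delta x)"])
  have "energy_inner E c (class_of (delta x)) k = l2_inner (laplace_delta x) f"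
    if "(f, k) \<in> op_A" for f k
  proof -
    from that obtain F :: "'v set" and a where "finite F"
      and f: "f = (\<lambda>v. \<Sum>y\<in>F. a y * delta y v)" and k: "k = class_of f"
      by (auto simp: op_A_def class_of_sum)
    \<comment> \<open>Point masses have modulus at most 1, so a finite combination is bounded by the
      sum of the moduli of its coefficients.\<close>
    have "cmod (f v) \<le> (\<Sum>y\<in>F. cmod (a y))" for v
      unfolding f by (rule sum_norm_le) (simp add: delta_def)
    from energy_inner_delta[OF c this] show ?thesis by (simp add: k)
  qed
  then show "(class_of (delta x), laplace_delta x) \<in> op_adjoint E c op_A"
    by (auto simp: op_adjoint_def delta_in_energy_space_iff c laplace_delta_in_l2)
qed

end

theorem theorem4p20:
  fixes E :: "('v \<times> 'v) set" and c :: "'v \<Rightarrow> 'v \<Rightarrow> real" and base x :: 'v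
  assumes "connected_network E c"
    and "x \<noteq> base"
  shows "(class_of (delta x) \<in> energy_space E c \<longleftrightarrow> total_conductance E c x < \<infinity>) \<and>
    (class_of (delta x) \<in> energy_space E c \<longrightarrow>
       ennreal ((energy_norm E c (class_of (delta x)))\<^sup>2) = total_conductance E c x) \<and>
    ((\<forall>y. class_of (delta y) \<in> energy_space E c) \<longrightarrow>
       (\<forall>P. spectral_measure_of (op_AstarA E c) P \<longrightarrow>
          (\<integral>\<^sup>+ t. ennreal t \<partial>spectral_dist P (delta x)) =
            ennreal ((energy_norm E c (class_of (delta x)))\<^sup>2))) \<and>
    ((\<forall>y. total_conductance E c y < \<infinity>) \<longrightarrow>
       (\<forall>P. spectral_measure_of (op_AstarA E c) P \<longrightarrow>
          (\<integral>\<^sup>+ t. ennreal (t\<^sup>2) \<partial>spectral_dist P (delta x)) =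
            (total_conductance E c x)\<^sup>2 + (\<Sum>\<^sub>\<infinity>y\<in>neighbours E x. ennreal ((c x y)\<^sup>2)))) \<and>
    ((\<forall>y. class_of (delta y) \<in> energy_space E c) \<longrightarrow>
       (\<forall>P. spectral_measure_of (op_AstarA E c) P \<longrightarrow>
          covariance (spectral_dist P (delta x)) =
            (\<Sum>\<^sub>\<infinity>y\<in>neighbours E x. ennreal ((c x y)\<^sup>2)) \<and>
          covariance (spectral_dist P (delta x)) \<le>
            ennreal ((energy_norm E c (class_of (delta x))) ^ 4)))"
proof -
  interpret connected_network E c by fact
  let ?N = "neighbours E x"
  let ?C = "infsum (c x) ?N" and ?Q = "\<Sum>\<^sub>\<infinity>y\<in>?N. (c x y)\<^sup>2"
  have C: "0 \<le> ?C" and Q: "0 \<le> ?Q"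
    by (auto intro: infsum_nonneg conductance_nonneg)
  \<comment> \<open>The mean is the inner product of \<open>delta x\<close> with
    \<open>laplace_delta x\<close>, that is, the value \<open>?C\<close> of the latter at
    \<open>x\<close>. Subtracting its square from the squared norm leaves \<open>?Q\<close>.\<close>
  have moments: "(\<integral>\<^sup>+ t. ennreal t \<partial>spectral_dist P (delta x)) = ennreal ?C"
    "(\<integral>\<^sup>+ t. ennreal (t\<^sup>2) \<partial>spectral_dist P (delta x)) = ennreal (?C\<^sup>2 + ?Q)"
    "covariance (spectral_dist P (delta x)) = ennreal ?Q"
    if "c x summable_on ?N" "spectral_measure_of (op_AstarA E c) P" for P
    using spectral_measure_moments[OF that(2) delta_laplace_in_AstarA[OF that(1)] l2_norm_delta, of ?C]
    by (simp_all add: l2_inner_delta laplace_delta_def l2_norm_laplace_delta that(1))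
  have squares: "(\<Sum>\<^sub>\<infinity>y\<in>?N. ennreal ((c x y)\<^sup>2)) = ennreal ?Q" "?Q \<le> ?C\<^sup>2"
    if "c x summable_on ?N"
    using that by (auto intro!: infsum_ennreal summable_on_power2 infsum_power2_le conductance_nonneg)
  \<comment> \<open>The squared energy norm of \<open>delta x\<close> is \<open>?C\<close>, so
    \<open>?Q \<le> ?C\<^sup>2\<close> is exactly the covariance bound.\<close>
  have norm4: "(energy_norm E c (class_of (delta x))) ^ 4 = ?C\<^sup>2" if "c x summable_on ?N"
    using energy_norm_delta[OF that] power_mult[of "energy_norm E c (class_of (delta x))" 2 2] by simp
  show ?thesis
    \<comment> \<open>Both finiteness conditions become summability of the conductances, which
      leaves identities between \<open>?C\<close> and \<open>?Q\<close>.\<close>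
    unfolding total_conductance_finite_iff delta_in_energy_space_iff
    using C Q
    by (intro conjI impI allI)
      (simp_all add: total_conductance_eq energy_norm_delta moments squares norm4 ennreal_power ennreal_plus ennreal_leI)
qed

end
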